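(* Let $0<q<1$, let $A_i,\alpha_i>0$, $a_i\ge 0$ for $i=1,\dots,p$ and $B_j,\beta_j>0$, $b_j\ge0$ for $j=1,\dots,s$, and for $x>0$ let $$W_q(x)=\frac{\prod_{i=1}^p\Gamma_q(A_ix+a_i)^{\alpha_i}}{\prod_{j=1}^s\Gamma_q(B_jx+b_j)^{\beta_j}}.$$ Let $\mu,\sigma$ be the non-negative measures on $(0,\infty)$ and $\hat{\mathcal A},\hat{\mathcal B}$ the sets defined in the context. Then the function $(\log W_q)''$ is completely monotonic if and only if $\tau:=\mu-\sigma$ is a non-negative measure, which, in turn, is equivalent to the following two conditions holding together: (1) $\hat{\mathcal B}\subset\hat{\mathcal A}$; equivalently, there exist $n_1,\dots,n_s\in\mathbb N$ and indices $i_1,\dots,i_s\in\{1,\dots,p\}$ (not necessarily distinct) such that $B_1=n_1A_{i_1}$, $B_2=n_2A_{i_2}$, $\dots$, $B_s=n_sA_{i_s}$; (2) for each $t\in\hat{\mathcal B}$, $$\sum_{\substack{(n,i):\, nA_i\log(1/q)=t}}\frac{n}{1-q^n}\,\alpha_iA_i^2q^{na_i}\;\ge\;\sum_{\substack{(m,j):\, mB_j\log(1/q)=t}}\frac{m}{1-q^m}\,\beta_jB_j^2q^{mb_j},$$ where the sums run over $n\in\mathbb N$, $1\le i\le p$ and $m\in\mathbb N$, $1\le j\le s$, respectively. In the affirmative case, for $x>0$, $$(\log W_q)''(x)=(\log q)^2\int_0^\infty e^{-xy}\,\tau(dy).$$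
   Context: $\mathbb N=\{1,2,3,\dots\}$. For $0<q<1$ and $x>0$ the $q$-gamma function is $\Gamma_q(x)=(1-q)^{1-x}\prod_{n=0}^\infty\frac{1-q^{n+1}}{1-q^{x+n}}$. A function $f:(0,\infty)\to\mathbb R$ is completely monotonic if it is infinitely differentiable, $f\ge0$, and $(-1)^nf^{(n)}(x)\ge0$ for all $n\ge1$, $x>0$. Sets: $\hat{\mathcal A}=\{nA_i\log(1/q): n\in\mathbb N,\ i=1,\dots,p\}$ and $\hat{\mathcal B}=\{mB_j\log(1/q): m\in\mathbb N,\ j=1,\dots,s\}$ (as sets, without repetitions). Measures: with $\delta_t$ the unit point mass at $t$, $$\mu=\sum_{i=1}^p\sum_{n=1}^\infty\frac{n}{1-q^n}\alpha_iA_i^2q^{na_i}\,\delta_{nA_i\log(1/q)},\qquad \sigma=\sum_{j=1}^s\sum_{m=1}^\infty\frac{m}{1-q^m}\beta_jB_j^2q^{mb_j}\,\delta_{mB_j\log(1/q)}.$$ Both measures are finite on bounded sets, and $\tau=\mu-\sigma$ is the corresponding signed (locally finite) discrete measure. *)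

theory Defs
  imports "HOL-Analysis.Analysis"
begin

definition q_Gamma :: "real \<Rightarrow> real \<Rightarrow> real" where
  "q_Gamma q x =
     (1 - q) powr (1 - x) * (\<Prod>n. (1 - q ^ (n + 1)) / (1 - q powr (x + real n)))"

text \<open>Functions on the open half-line are represented by total functions on the reals.  Since
  derivatives are local, the values outside \<open>{0<..}\<close> play no role below.\<close>

definition completely_monotonic :: "(real \<Rightarrow> real) \<Rightarrow> bool" where
  "completely_monotonic f \<longleftrightarrow>
     (\<forall>n. \<forall>x>0. (deriv ^^ n) f field_differentiable (at x)) \<and>
     (\<forall>x>0. f x \<ge> 0) \<and>
     (\<forall>n\<ge>1. \<forall>x>0. (-1) ^ n * (deriv ^^ n) f x \<ge> 0)"

definition q_Gamma_quotient ::
  "real \<Rightarrow> nat \<Rightarrow> (nat \<Rightarrow> real) \<Rightarrow> (nat \<Rightarrow> real) \<Rightarrow> (nat \<Rightarrow> real) \<Rightarrow>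
   nat \<Rightarrow> (nat \<Rightarrow> real) \<Rightarrow> (nat \<Rightarrow> real) \<Rightarrow> (nat \<Rightarrow> real) \<Rightarrow> real \<Rightarrow> real" where
  "q_Gamma_quotient q p A a \<alpha> s B b \<beta> x =
     (\<Prod>i=1..p. q_Gamma q (A i * x + a i) powr \<alpha> i) /
     (\<Prod>j=1..s. q_Gamma q (B j * x + b j) powr \<beta> j)"

definition support_points :: "real \<Rightarrow> nat \<Rightarrow> (nat \<Rightarrow> real) \<Rightarrow> real set" where
  "support_points q p A = {real n * A i * ln (1 / q) | n i. n \<ge> 1 \<and> i \<in> {1..p}}"

definition atom_weight ::
  "real \<Rightarrow> (nat \<Rightarrow> real) \<Rightarrow> (nat \<Rightarrow> real) \<Rightarrow> (nat \<Rightarrow> real) \<Rightarrow> nat \<Rightarrow> nat \<Rightarrow> real" where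
  "atom_weight q A a \<alpha> i n =
     real n / (1 - q ^ n) * \<alpha> i * (A i)\<^sup>2 * q powr (real n * a i)"

abbreviation half_line :: "real measure" where
  "half_line \<equiv> restrict_space borel {0<..}"

text \<open>The sum of weighted point masses is the image of the weighted counting measure on the index
  set under \<open>(i, n) \<mapsto> n A\<^sub>i log (1/q)\<close>; see \<open>emeasure_discrete_measure\<close> for the sum
  of point masses itself.\<close>

definition discrete_measure ::
  "real \<Rightarrow> nat \<Rightarrow> (nat \<Rightarrow> real) \<Rightarrow> (nat \<Rightarrow> real) \<Rightarrow> (nat \<Rightarrow> real) \<Rightarrow> real measure" where
  "discrete_measure q p A a \<alpha> =
     distr (point_measure ({1..p} \<times> {1..}) (\<lambda>(i, n). ennreal (atom_weight q A a \<alpha> i n)))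
       half_line (\<lambda>(i, n). real n * A i * ln (1 / q))"

text \<open>Both measures may have infinite total mass, so their difference is a real-valued set function
  on the bounded measurable sets only, where both are finite
  (\<open>emeasure_discrete_measure_bounded\<close>).\<close>

definition signed_diff :: "real measure \<Rightarrow> real measure \<Rightarrow> real set \<Rightarrow> real" where
  "signed_diff \<mu> \<sigma> S = measure \<mu> S - measure \<sigma> S"

text \<open>\<open>represents \<nu> \<tau>\<close>: the locally finite signed measure \<open>\<tau>\<close> is the non-negative measure
  \<open>\<nu>\<close>.  There is at most one such \<open>\<nu>\<close>, by continuity from below along
  \<open>{0<..k}\<close>.\<close>

definition represents :: "real measure \<Rightarrow> (real set \<Rightarrow> real) \<Rightarrow> bool" where
  "represents \<nu> \<tau> \<longleftrightarrow> sets \<nu> = sets half_line \<and>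
     (\<forall>S\<in>sets half_line. bounded S \<longrightarrow> emeasure \<nu> S < \<infinity> \<and> measure \<nu> S = \<tau> S)"

definition is_nonneg_measure :: "(real set \<Rightarrow> real) \<Rightarrow> bool" where
  "is_nonneg_measure \<tau> \<longleftrightarrow> (\<exists>\<nu>. represents \<nu> \<tau>)"

lemma emeasure_discrete_measure:
  assumes q: "0 < q" "q < 1" and A: "\<And>i. i \<in> {1..p} \<Longrightarrow> A i > 0"
    and S: "S \<in> sets half_line"
  shows "emeasure (discrete_measure q p A a \<alpha>) S =
    (\<Sum>i=1..p. \<Sum>n. ennreal (atom_weight q A a \<alpha> i (Suc n)) *
       indicator S (real (Suc n) * A i * ln (1 / q)))"
proof -
  let ?I = "{1..p} \<times> {1::nat..}"
  let ?w = "\<lambda>(i, n). ennreal (atom_weight q A a \<alpha> i n)"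
  let ?f = "\<lambda>(i, n). real n * A i * ln (1 / q)"
  let ?g = "\<lambda>i n. ennreal (atom_weight q A a \<alpha> i n) * indicator S (real n * A i * ln (1 / q))"
  have l: "ln (1 / q) > 0" using q by simp
  have f: "?f \<in> measurable (point_measure ?I ?w) half_line"
    using A l by (auto simp: point_measure_def space_restrict_space)
  have "emeasure (discrete_measure q p A a \<alpha>) S = emeasure (point_measure ?I ?w) (?f -` S \<inter> ?I)"
    unfolding discrete_measure_def using emeasure_distr[OF f S] by (simp add: space_point_measure)
  also have "\<dots> = (\<integral>\<^sup>+z. ?w z * indicator (?f -` S \<inter> ?I) z \<partial>count_space ?I)"
    unfolding point_measure_def by (rule emeasure_density) auto
  also have "\<dots> = (\<integral>\<^sup>+z. (case z of (i, n) \<Rightarrow> ?g i n) \<partial>count_space ?I)"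
    by (rule nn_integral_cong) (auto simp: indicator_def)
  also have "\<dots> = (\<integral>\<^sup>+i. \<integral>\<^sup>+n. ?g i n \<partial>count_space {1..} \<partial>count_space {1..p})"
  proof -
    interpret sigma_finite_measure "count_space {1::nat..}"
      by (rule sigma_finite_measure_count_space_countable) auto
    have "count_space {1..p} \<Otimes>\<^sub>M count_space {1::nat..} = count_space ?I"
      by (rule pair_measure_countable) auto
    then show ?thesis
      using nn_integral_fst[of "\<lambda>(i, n). ?g i n" "count_space {1..p}"] by simp
  qed
  also have "\<dots> = (\<Sum>i=1..p. \<integral>\<^sup>+n. ?g i n \<partial>count_space {1..})"
    by (rule nn_integral_count_space_finite) auto
  also have "\<dots> = (\<Sum>i=1..p. \<Sum>n. ?g i (Suc n))"
  proof (rule sum.cong)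
    fix i
    have b: "bij_betw Suc UNIV {1..}"
      by (intro bij_betwI[where g = "\<lambda>n. n - 1"]) auto
    have "(\<integral>\<^sup>+n. ?g i n \<partial>count_space {1..}) = (\<integral>\<^sup>+n. ?g i (Suc n) \<partial>count_space UNIV)"
      using nn_integral_bij_count_space[OF b, of "?g i"] by simp
    then show "(\<integral>\<^sup>+n. ?g i n \<partial>count_space {1..}) = (\<Sum>n. ?g i (Suc n))"
      by (simp add: nn_integral_count_space_nat)
  qed simp
  finally show ?thesis .
qed

lemma emeasure_discrete_measure_bounded:
  assumes q: "0 < q" "q < 1" and A: "\<And>i. i \<in> {1..p} \<Longrightarrow> A i > 0"
    and S: "S \<in> sets half_line" and "bounded S"
  shows "emeasure (discrete_measure q p A a \<alpha>) S < \<infinity>"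
proof -
  have l: "ln (1 / q) > 0" using q by simp
  obtain R where R: "\<And>x. x \<in> S \<Longrightarrow> x \<le> R"
    using \<open>bounded S\<close> unfolding bounded_real by (meson abs_le_D1)
  have "(\<Sum>n. ennreal (atom_weight q A a \<alpha> i (Suc n)) *
       indicator S (real (Suc n) * A i * ln (1 / q))) < \<infinity>"
    if i: "i \<in> {1..p}" for i
  proof -
    define N where "N = nat \<lceil>R / (A i * ln (1 / q))\<rceil>"
    have c: "A i * ln (1 / q) > 0" using A[OF i] l by simp
    have "real (Suc n) * A i * ln (1 / q) \<notin> S" if "n \<notin> {..<N}" for n
    proof
      assume "real (Suc n) * A i * ln (1 / q) \<in> S"
      then have "real (Suc n) * (A i * ln (1 / q)) \<le> R" using R by (simp add: mult.assoc)
      then have "real (Suc n) \<le> R / (A i * ln (1 / q))" using c pos_le_divide_eq by blast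
      then show False using that unfolding N_def by simp linarith
    qed
    then have z: "(\<Sum>n. ennreal (atom_weight q A a \<alpha> i (Suc n)) *
       indicator S (real (Suc n) * A i * ln (1 / q))) =
       (\<Sum>n<N. ennreal (atom_weight q A a \<alpha> i (Suc n)) *
       indicator S (real (Suc n) * A i * ln (1 / q)))"
      using S by (intro suminf_finite) (auto simp del: of_nat_Suc)
    show ?thesis unfolding z using S
      by (auto simp: ennreal_mult_less_top indicator_def simp del: of_nat_Suc)
  qed
  then have "(\<Sum>i=1..p. \<Sum>n. ennreal (atom_weight q A a \<alpha> i (Suc n)) *
       indicator S (real (Suc n) * A i * ln (1 / q))) < \<infinity>"
    by (simp del: of_nat_Suc)
  then show ?thesis
    by (subst emeasure_discrete_measure) (use q A S in auto)
qed

end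

theory Submission
  imports Defs
begin

text \<open>
  Expanding the logarithms in the product formula gives
  \<open>log \<Gamma>\<^sub>q(x) = (1 - x) log (1 - q) + G(x) - G(1)\<close> with
  \<open>G(x) = \<Sum>\<^sub>k q\<^sup>k\<^sup>x / (k (1 - q\<^sup>k))\<close>.  This holds because
  \<open>G(x) - G(x + 1) = - log (1 - q\<^sup>x)\<close>, which is the Taylor series of the logarithm, and
  \<open>G(x + N) \<longlonglongrightarrow> 0\<close> (\<open>q_log_series_diff\<close>, \<open>q_log_series_sums\<close>, \<open>q_Gamma_eq_exp\<close>).
  Differentiating twice, termwise, kills the affine part, and
  \<open>(log W\<^sub>q)''\<close> becomes \<open>(log q)\<^sup>2\<close> times the Laplace transform of \<open>\<mu>\<close> minus that of \<open>\<sigma>\<close>.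
  Further differentiation inserts a factor \<open>(- t)\<^sup>k\<close> under the Laplace integral
  (\<open>higher_deriv_log_ratio''\<close>).

  Both measures are purely atomic, so everything is decided by the excess
  \<open>\<mu>{t} - \<sigma>{t}\<close> at each point \<open>t > 0\<close>: complete monotonicity, nonnegativity of \<open>\<tau>\<close>,
  and the two arithmetic conditions are each equivalent to nonnegative excess everywhere.
  If the excess is nonnegative, the weights \<open>excess t\<close> define a measure that represents
  \<open>\<tau>\<close> and all signed derivatives are nonnegative integrals against it.
  Conversely, complete monotonicity forces nonnegative excess because a discrete form of the
  Post--Widder inversion formula (\<open>exp_series_Post_Widder\<close>) recovers each atom as a limit of
  rescaled derivatives: a negative excess at \<open>t\<close> would make the \<open>k\<close>-th derivative at \<open>k/t\<close>
  have the wrong sign for large \<open>k\<close>.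

  The integral formula follows as a measure representing \<open>\<tau>\<close> is unique
  (\<open>represents_unique\<close>) and hence is the one built from the excess.
\<close>

section \<open>Series of equally spaced exponentials\<close>

text \<open>Allowing arbitrary coefficients makes this lemma iterable: the differentiated series has the
  same shape.\<close>

lemma exp_series_derivative:
  fixes c :: "nat \<Rightarrow> real"
  assumes d: "d > 0" and c: "\<And>x. x > 0 \<Longrightarrow> summable (\<lambda>n. c n * exp (- (x * (real n * d))))"
    and x: "x > 0"
  shows "summable (\<lambda>n. c n * (real n * d) * exp (- (x * (real n * d))))" (is ?summable)
    and "((\<lambda>x. \<Sum>n. c n * exp (- (x * (real n * d)))) has_real_derivative
         - (\<Sum>n. c n * (real n * d) * exp (- (x * (real n * d))))) (at x)" (is ?deriv)
proof -
  \<comment> \<open>In the variable \<open>z = e\<^sup>-\<^sup>d\<^sup>x\<close> the series is a power series convergent on the unit disc.\<close>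
  define z where "z = exp (- (x * d))"
  have e: "exp (- (x * (real n * d))) = exp (- (x * d)) ^ n" for n and x :: real
    by (simp add: exp_of_nat_mult [symmetric] algebra_simps)
  have z: "0 < z" "norm z < 1" using d x by (auto simp: z_def)
  have sm: "summable (\<lambda>n. c n * y ^ n)" if y: "norm y < 1" for y :: real
  proof (cases "y = 0")
    case False
    \<comment> \<open>The hypothesis at \<open>v\<close> is convergence at the midpoint of \<open>norm y\<close> and 1.\<close>
    define v where "v = (- ln ((norm y + 1) / 2)) / d"
    have "ln ((norm y + 1) / 2) < 0" using y by (subst ln_less_zero_iff) (auto intro: add_nonneg_pos)
    then have "v > 0" using d unfolding v_def by (intro divide_pos_pos) auto
    moreover have v: "exp (- (v * d)) = (norm y + 1) / 2"
      using d False by (simp add: v_def add_pos_pos)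
    ultimately have s: "summable (\<lambda>n. c n * ((norm y + 1) / 2) ^ n)"
      using c[of v] unfolding e v by simp
    show ?thesis by (rule powser_inside [OF s]) (use y in auto)
  qed (simp add: powser_zero)
  have "summable (\<lambda>n. diffs c n * z ^ n)"
    using termdiff_converges[OF z(2) sm] .
  then have sd: "summable (\<lambda>n. d * z * (diffs c n * z ^ n))"
    by (rule summable_mult)
  have shift: "d * z * (diffs c n * z ^ n) = c (Suc n) * (real (Suc n) * d) * exp (- (x * (real (Suc n) * d)))"
    for n
    unfolding e z_def [symmetric] by (simp add: diffs_def)
  show sum: ?summable
    by (subst summable_Suc_iff [symmetric]) (use sd in \<open>simp only: shift\<close>)
  have total: "(\<Sum>n. c n * (real n * d) * exp (- (x * (real n * d)))) = d * z * (\<Sum>n. diffs c n * z ^ n)"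
    using suminf_split_head[OF sum] suminf_mult[OF \<open>summable (\<lambda>n. diffs c n * z ^ n)\<close>, of "d * z"]
    by (simp only: shift)
  have "((\<lambda>y. \<Sum>n. c n * y ^ n) has_field_derivative (\<Sum>n. diffs c n * z ^ n)) (at z)"
    by (rule termdiffs_strong'[OF sm z(2)])
  moreover have "((\<lambda>x. exp (- (x * d))) has_field_derivative (z * - d)) (at x)"
    by (auto intro!: derivative_eq_intros simp: z_def)
  ultimately have "((\<lambda>x. \<Sum>n. c n * exp (- (x * d)) ^ n) has_field_derivative
      ((\<Sum>n. diffs c n * z ^ n) * (z * - d))) (at x)"
    unfolding z_def by (rule DERIV_chain2)
  moreover have "(\<lambda>x. \<Sum>n. c n * exp (- (x * (real n * d)))) = (\<lambda>x. \<Sum>n. c n * exp (- (x * d)) ^ n)"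
    by (simp only: e)
  ultimately show ?deriv
    unfolding total by (simp add: mult_ac)
qed

lemma summable_exp_series_power:
  fixes c :: "nat \<Rightarrow> real"
  assumes d: "d > 0" and c: "\<And>x. x > 0 \<Longrightarrow> summable (\<lambda>n. c n * exp (- (x * (real n * d))))"
    and x: "x > 0"
  shows "summable (\<lambda>n. c n * (real n * d) ^ k * exp (- (x * (real n * d))))"
  using x
proof (induction k arbitrary: x)
  case (Suc k)
  show ?case
    using exp_series_derivative(1)[OF d Suc.IH Suc.prems] by (simp add: mult_ac)
qed (use c in simp)

lemma mult_exp_one_minus_le_1: "u * exp (1 - u) \<le> 1" for u :: real
proof -
  have "u \<le> exp (u - 1)" using exp_ge_add_one_self[of "u - 1"] by simp
  then have "u * exp (1 - u) \<le> exp (u - 1) * exp (1 - u)" by (intro mult_right_mono) auto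
  then show ?thesis by (simp flip: exp_add)
qed

lemma mult_exp_one_minus_less_1: "u * exp (1 - u) < 1" if "u \<noteq> 1" for u :: real
proof -
  have "u < exp (u - 1)" using exp_minus_greater[of "1-u"] that  by simp
  then have "u * exp (1 - u) < exp (u - 1) * exp (1 - u)" by (intro mult_strict_right_mono) auto
  then show ?thesis by (simp flip: exp_add)
qed

text \<open>This is the discrete form of the Post--Widder inversion formula.  Evaluating the
  \<open>k\<close>-th derivative at \<open>k/t\<close> and rescaling turns the factor of \<open>c n\<close> into
  \<open>(u e\<^sup>1\<^sup>-\<^sup>u)\<^sup>k\<close> with \<open>u = n d / t\<close>.  As \<open>u e\<^sup>1\<^sup>-\<^sup>u\<close> has its strict maximum 1 at
  \<open>u = 1\<close>, the powers converge to the indicator of \<open>n d = t\<close>, and for \<open>k \<ge> 1\<close> they are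
  dominated by the case \<open>k = 1\<close>, so Tannery's theorem applies.\<close>

lemma exp_series_Post_Widder:
  fixes c :: "nat \<Rightarrow> real"
  assumes d: "d > 0" and c: "\<And>x. x > 0 \<Longrightarrow> summable (\<lambda>n. c n * exp (- (x * (real n * d))))"
    and nonneg: "\<And>n. c n \<ge> 0" and t: "t > 0"
  shows "(\<lambda>k. (exp 1 / t) ^ k * (\<Sum>n. c n * (real n * d) ^ k * exp (- (real k / t * (real n * d)))))
    \<longlonglongrightarrow> (\<Sum>n. if real n * d = t then c n else 0)"
proof -
  define g where "g n = real n * d / t * exp (1 - real n * d / t)" for n
  have g: "0 \<le> g n" "g n \<le> 1" for n
    using d t mult_exp_one_minus_le_1[of "real n * d / t"] unfolding g_def by auto
  have eq: "(exp 1 / t) ^ k * (c n * (real n * d) ^ k * exp (- (real k / t * (real n * d)))) = c n * g n ^ k" for n k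
  proof -
    have "exp (- (real k / t * (real n * d))) = exp (- (real n * d / t)) ^ k"
      by (simp add: exp_of_nat_mult [symmetric] algebra_simps)
    then show ?thesis
      by (simp add: g_def exp_diff exp_minus power_mult_distrib power_divide field_simps)
  qed
  have "summable (\<lambda>n. (exp 1 / t) ^ 1 * (c n * (real n * d) ^ 1 * exp (- (real 1 / t * (real n * d)))))"
    by (intro summable_mult summable_exp_series_power[OF d c]) (use t in auto)
  then have M: "summable (\<lambda>n. c n * g n)" unfolding eq by simp
  have lim: "(\<lambda>k. c n * g n ^ k) \<longlonglongrightarrow> (if real n * d = t then c n else 0)" for n
  proof (cases "real n * d = t")
    case True
    then show ?thesis using t by (simp add: g_def)
  next
    case False
    then have "g n < 1" using t mult_exp_one_minus_less_1[of "real n * d / t"] by (auto simp: g_def)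
    then show ?thesis using False g[of n]
      by (auto intro!: tendsto_mult_right_zero LIMSEQ_power_zero)
  qed
  have ev: "\<forall>\<^sub>F (n, k) in at_top \<times>\<^sub>F sequentially. norm (c n * g n ^ k) \<le> c n * g n"
  proof (unfold eventually_prod_filter, rule exI[of _ "\<lambda>_. True"], rule exI[of _ "\<lambda>k. k \<ge> 1"],
      intro conjI allI impI)
    show "\<forall>\<^sub>F k::nat in sequentially. k \<ge> 1" by (rule eventually_ge_at_top)
    show "\<forall>\<^sub>F n::nat in sequentially. True" by simp
    fix n k :: nat assume "k \<ge> 1"
    then have "g n ^ k \<le> g n" using power_decreasing[of 1 k "g n"] g by simp
    then show "case (n, k) of (n, k) \<Rightarrow> norm (c n * g n ^ k) \<le> c n * g n"
      using nonneg[of n] g[of n] by (auto simp: abs_mult intro!: mult_left_mono)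
  qed
  have "(\<lambda>k. \<Sum>n. c n * g n ^ k) \<longlonglongrightarrow> (\<Sum>n. if real n * d = t then c n else 0)"
    using tannerys_theorem[OF lim ev M] by simp
  moreover have "\<forall>\<^sub>F k in sequentially. 
      (exp 1 / t) ^ k * (\<Sum>n. c n * (real n * d) ^ k * exp (- (real k / t * (real n * d))))
      = (\<Sum>n. c n * g n ^ k)"
  proof (rule eventually_mono[OF eventually_gt_at_top[of 0]])
    fix k :: nat assume "k > 0"
    then have "summable (\<lambda>n. c n * (real n * d) ^ k * exp (- (real k / t * (real n * d))))"
      by (intro summable_exp_series_power[OF d c]) (use t in auto)
    from suminf_mult[OF this, of "(exp 1 / t) ^ k"]
    show "(exp 1 / t) ^ k * (\<Sum>n. c n * (real n * d) ^ k * exp (- (real k / t * (real n * d)))) = (\<Sum>n. c n * g n ^ k)"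
      by (simp only: eq)
  qed
  ultimately show ?thesis by (simp only: tendsto_cong)
qed

section \<open>The logarithm of the \<open>q\<close>-gamma function\<close>

text \<open>At \<open>z = q\<^sup>x\<close> this is the part of \<open>log \<Gamma>\<^sub>q(x)\<close> that is not affine in \<open>x\<close>.  The
  term at index 0 vanishes, as division by zero yields zero.\<close>

definition q_log_series :: "real \<Rightarrow> real \<Rightarrow> real" where
  "q_log_series q z = (\<Sum>n. 1 / (real n * (1 - q ^ n)) * z ^ n)"

lemma summable_q_log_series:
  assumes q: "0 < q" "q < 1" and z: "norm z < 1"
  shows "summable (\<lambda>n. 1 / (real n * (1 - q ^ n)) * z ^ n)"
proof (rule summable_comparison_test')
  show "summable (\<lambda>n. 1 / (1 - q) * norm z ^ n)"
    using z by (intro summable_mult summable_geometric) auto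
  fix n :: nat
  have "1 / (real n * (1 - q ^ n)) \<le> 1 / (1 - q)" if "n \<ge> 1"
  proof -
    have "q ^ n \<le> q ^ 1" using that q by (intro power_decreasing) auto
    then have "1 * (1 - q) \<le> real n * (1 - q ^ n)"
      using that q by (intro mult_mono) auto
    moreover have "0 < 1 * (1 - q)" using q by simp
    ultimately show ?thesis by (intro divide_left_mono) (auto simp: mult_pos_pos)
  qed
  moreover have "0 \<le> 1 / (real n * (1 - q ^ n))" using q by (auto intro!: mult_nonneg_nonneg simp: power_le_one)
  ultimately have "\<bar>1 / (real n * (1 - q ^ n))\<bar> \<le> 1 / (1 - q)" using q by (cases n) auto
  then show "norm (1 / (real n * (1 - q ^ n)) * z ^ n) \<le> 1 / (1 - q) * norm z ^ n"
    unfolding norm_mult norm_power by (intro mult_right_mono) auto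
qed

text \<open>The coefficients are chosen such that \<open>z\<^sup>n - (q z)\<^sup>n\<close> cancels the factor \<open>1 - q\<^sup>n\<close> and
  leaves the Taylor series of the logarithm.\<close>

lemma q_log_series_diff:
  assumes q: "0 < q" "q < 1" and z: "norm z < 1"
  shows "q_log_series q z - q_log_series q (q * z) = - ln (1 - z)"
proof -
  have "(\<lambda>n. - ((- (- z)) ^ n) / of_nat n) sums ln (1 + - z)"
    by (rule ln_series') (use z in auto)
  then have ln: "(\<lambda>n. z ^ n / real n) sums - ln (1 - z)"
    using sums_minus by fastforce
  have "norm (q * z) < 1" using q z by (simp add: norm_mult mult_strict_mono abs_mult)
      (meson abs_ge_zero mult_left_le_one_le not_le le_less_trans less_eq_real_def)
  then have s: "summable (\<lambda>n. 1 / (real n * (1 - q ^ n)) * (q * z) ^ n)" 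
    by (rule summable_q_log_series[OF q])
  have "q_log_series q z - q_log_series q (q * z) = 
    (\<Sum>n. 1 / (real n * (1 - q ^ n)) * z ^ n - 1 / (real n * (1 - q ^ n)) * (q * z) ^ n)"
    unfolding q_log_series_def by (rule suminf_diff[OF summable_q_log_series[OF q z] s])
  also have "\<dots> = (\<Sum>n. z ^ n / real n)"
  proof (rule suminf_cong)
    fix n
    show "1 / (real n * (1 - q ^ n)) * z ^ n - 1 / (real n * (1 - q ^ n)) * (q * z) ^ n = z ^ n / real n"
    proof (cases n)
      case (Suc m)
      then have "q ^ n \<noteq> 1" using q by (metis power_strict_decreasing zero_less_Suc power_0 less_irrefl)
      then have "1 / (real n * (1 - q ^ n)) * (1 - q ^ n) = 1 / real n" by simp
      moreover have "1 / (real n * (1 - q ^ n)) * z ^ n - 1 / (real n * (1 - q ^ n)) * (q * z) ^ n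
          = 1 / (real n * (1 - q ^ n)) * (1 - q ^ n) * z ^ n"
        by (simp add: power_mult_distrib right_diff_distrib left_diff_distrib diff_divide_distrib mult_ac)
      ultimately show ?thesis by simp
    qed simp
  qed
  also have "\<dots> = - ln (1 - z)" using ln by (simp add: sums_iff)
  finally show ?thesis .
qed

lemma powr_less_1: "0 < q \<Longrightarrow> q < 1 \<Longrightarrow> x > 0 \<Longrightarrow> q powr x < 1" for q x :: real
  using powr_less_mono'[of q 0 x] by simp

text \<open>The previous lemma makes this a telescoping sum, and \<open>q\<^sup>x\<^sup>+\<^sup>n\<close> tends to 0, where the power
  series vanishes.\<close>

lemma q_log_series_sums:
  assumes q: "0 < q" "q < 1" and x: "x > 0"
  shows "(\<lambda>n. - ln (1 - q powr (x + real n))) sums q_log_series q (q powr x)"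
proof -
  define G where "G = (\<lambda>n. q_log_series q (q powr (x + real n)))"
  have lt: "q powr (x + real n) < 1" for n by (rule powr_less_1) (use q x in auto)
  have step: "G n - G (Suc n) = - ln (1 - q powr (x + real n))" for n
  proof -
    have "q powr (x + real (Suc n)) = q * q powr (x + real n)"
      using powr_add[of q 1 "x + real n"] q by (simp add: add_ac)
    then show ?thesis unfolding G_def
      using q_log_series_diff[OF q, of "q powr (x + real n)"] lt[of n] by simp
  qed
  have "(q_log_series q \<longlongrightarrow> 1 / (real 0 * (1 - q ^ 0))) (at 0)"
    unfolding q_log_series_def
    by (rule powser_limit_0[of 1, OF _ summable_sums[OF summable_q_log_series[OF q]]]) auto
  then have "(q_log_series q \<longlongrightarrow> 0) (at 0)" by simp
  moreover have "filterlim (\<lambda>n. q powr (x + real n)) (at 0) sequentially"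
  proof (rule filterlim_atI)
    have "(\<lambda>n. q powr x * q ^ n) \<longlonglongrightarrow> q powr x * 0"
      using q by (intro tendsto_mult tendsto_const LIMSEQ_power_zero) auto
    then show "(\<lambda>n. q powr (x + real n)) \<longlonglongrightarrow> 0"
      using q by (simp add: powr_add powr_realpow)
  qed (use q in auto)
  ultimately have "G \<longlonglongrightarrow> 0" unfolding G_def by (rule filterlim_compose)
  from telescope_sums'[OF this] show ?thesis by (simp add: step) (simp add: G_def)
qed

lemma q_Gamma_eq_exp:
  assumes q: "0 < q" "q < 1" and x: "x > 0"
  shows "q_Gamma q x = exp ((1 - x) * ln (1 - q) + q_log_series q (q powr x) - q_log_series q q)"
proof -
  let ?f = "\<lambda>n. - ln (1 - q powr (x + real n)) - - ln (1 - q powr (1 + real n))"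
  have f: "?f sums (q_log_series q (q powr x) - q_log_series q (q powr 1))"
    by (intro sums_diff q_log_series_sums q x) auto
  have "(1 - q ^ (n + 1)) / (1 - q powr (x + real n)) = exp (?f n)" for n
  proof -
    have "q powr (x + real n) < 1" "q powr (1 + real n) < 1"
      by (rule powr_less_1; use q x in simp)+
    moreover have "q powr (1 + real n) = q ^ (n + 1)" using q powr_realpow[of q "n+1"] by (simp add: add_ac)
    ultimately show ?thesis by (simp add: exp_diff exp_minus field_simps)
  qed
  then have "(\<Prod>n. (1 - q ^ (n + 1)) / (1 - q powr (x + real n))) = exp (suminf ?f)"
    using prodinf_exp[OF sums_summable[OF f]] by simp
  also have "\<dots> = exp (q_log_series q (q powr x) - q_log_series q q)"
    using f q by (simp add: sums_iff)
  finally show ?thesis using q by (simp add: q_Gamma_def powr_def exp_add exp_diff)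
qed

section \<open>A weighted product of \<open>q\<close>-gamma functions\<close>

text \<open>Numerator and denominator of \<open>W\<^sub>q\<close> are instances of this locale.\<close>

locale q_Gamma_product =
  fixes q :: real and p :: nat and A a \<alpha> :: "nat \<Rightarrow> real"
  assumes q_pos: "0 < q" and q_less_1: "q < 1"
    and params: "\<And>i. i \<in> {1..p} \<Longrightarrow> A i > 0 \<and> \<alpha> i > 0 \<and> a i \<ge> 0"
begin

definition spacing :: "nat \<Rightarrow> real" where
  "spacing i = A i * ln (1 / q)"

abbreviation node :: "nat \<Rightarrow> nat \<Rightarrow> real" where
  "node i n \<equiv> real n * spacing i"

abbreviation weight :: "nat \<Rightarrow> nat \<Rightarrow> real" where
  "weight \<equiv> atom_weight q A a \<alpha>"

definition mass :: "real \<Rightarrow> real" where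
  "mass t = (\<Sum>(n, i) | n \<ge> 1 \<and> i \<in> {1..p} \<and> real n * A i * ln (1 / q) = t. weight i n)"

text \<open>Up to the sign \<open>(-1)\<^sup>k\<close>, this is the \<open>k\<close>-th derivative of the Laplace transform of the
  discrete measure.\<close>

definition moment :: "nat \<Rightarrow> real \<Rightarrow> real" where
  "moment k x = (\<Sum>i=1..p. \<Sum>n. weight i n * node i n ^ k
     * exp (- (x * node i n)))"

lemma spacing_pos: "i \<in> {1..p} \<Longrightarrow> spacing i > 0"
  using params[of i] q_pos q_less_1 by (simp add: spacing_def)

lemma weight_0 [simp]: "weight i 0 = 0"
  by (simp add: atom_weight_def)

lemma weight_pos:
  assumes "i \<in> {1..p}" "n \<ge> 1"
  shows "weight i n > 0"
proof -
  have "q ^ n < 1" using assms q_pos q_less_1 by (simp add: power_less_one_iff)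
  then show ?thesis using params[OF assms(1)] assms q_pos by (auto simp: atom_weight_def)
qed

lemma weight_nonneg: "i \<in> {1..p} \<Longrightarrow> weight i n \<ge> 0"
  using weight_pos[of i n] by (cases n) auto

text \<open>These are the coefficients of the non-affine part of
  \<open>\<alpha>\<^sub>i log \<Gamma>\<^sub>q (A\<^sub>i x + a\<^sub>i)\<close> in its expansion into the exponentials \<open>exp (- x n A\<^sub>i log (1/q))\<close>.\<close>

definition log_coeff :: "nat \<Rightarrow> nat \<Rightarrow> real" where
  "log_coeff i n = \<alpha> i * q powr (real n * a i) / (real n * (1 - q ^ n))"

lemma log_coeff_exp:
  "log_coeff i n * exp (- (x * node i n))
     = \<alpha> i * (1 / (real n * (1 - q ^ n)) * (q powr (A i * x + a i)) ^ n)"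
proof -
  have "(q powr (A i * x + a i)) ^ n = q powr (real n * (A i * x + a i))"
    using q_pos by (simp add: powr_power mult.commute)
  also have "\<dots> = q powr (real n * a i) * q powr (real n * A i * x)"
    by (simp add: algebra_simps flip: powr_add)
  also have "q powr (real n * A i * x) = exp (- (x * node i n))"
    using q_pos by (simp add: powr_def spacing_def ln_div algebra_simps)
  finally show ?thesis by (simp add: log_coeff_def)
qed

lemma log_coeff_second_moment:
  "log_coeff i n * node i n ^ 2 = (ln q)\<^sup>2 * weight i n"
proof (cases "n = 0")
  case False
  then have "q ^ n \<noteq> 1" using q_pos q_less_1 power_less_one_iff[of q n] by auto
  then show ?thesis using False q_pos
    by (simp add: log_coeff_def atom_weight_def spacing_def ln_div power2_eq_square field_simps)
qed (simp add: log_coeff_def)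

lemma argument_pos: "i \<in> {1..p} \<Longrightarrow> x > 0 \<Longrightarrow> A i * x + a i > 0"
  using params[of i] by (simp add: add_pos_nonneg)

lemma norm_powr_argument: "i \<in> {1..p} \<Longrightarrow> x > 0 \<Longrightarrow> norm (q powr (A i * x + a i)) < 1"
  using powr_less_1[OF q_pos q_less_1 argument_pos, of i x] by simp

lemma summable_log_coeff:
  assumes "i \<in> {1..p}" "x > 0"
  shows "summable (\<lambda>n. log_coeff i n * exp (- (x * node i n)))"
  unfolding log_coeff_exp
  by (intro summable_mult summable_q_log_series q_pos q_less_1 norm_powr_argument assms)

text \<open>By \<open>log_coeff_second_moment\<close> the weights are, up to \<open>(log q)\<^sup>2\<close>, the coefficients
  of the second derivative of a convergent series, so convergence is inherited from termwise differentiation.\<close>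

lemma summable_weight:
  assumes i: "i \<in> {1..p}" and x: "x > 0"
  shows "summable (\<lambda>n. weight i n * exp (- (x * node i n)))"
proof -
  have "summable (\<lambda>n. log_coeff i n * node i n ^ 2 * exp (- (x * node i n)))"
    by (rule summable_exp_series_power[OF spacing_pos[OF i] summable_log_coeff[OF i] x])
  then have "summable (\<lambda>n. inverse ((ln q)\<^sup>2) * (log_coeff i n * node i n ^ 2 * exp (- (x * node i n))))"
    by (rule summable_mult)
  then show ?thesis using q_pos q_less_1 by (simp add: log_coeff_second_moment mult.assoc)
qed

lemma summable_moment:
  assumes "i \<in> {1..p}" "x > 0"
  shows "summable (\<lambda>n. weight i n * node i n ^ k * exp (- (x * node i n)))"
  by (intro summable_exp_series_power[OF spacing_pos summable_weight] assms)

lemma moment_has_derivative: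
  assumes x: "x > 0"
  shows "(moment k has_real_derivative - moment (Suc k) x) (at x)"
  unfolding moment_def sum_negf [symmetric]
proof (rule DERIV_sum)
  fix i assume i: "i \<in> {1..p}"
  show "((\<lambda>x. \<Sum>n. weight i n * node i n ^ k * exp (- (x * node i n)))
     has_real_derivative
      - (\<Sum>n. weight i n * node i n ^ Suc k * exp (- (x * node i n)))) (at x)"
    using exp_series_derivative(2)[OF spacing_pos[OF i] summable_moment[OF i] x, of k]
    by (simp add: mult_ac)
qed

definition log_product :: "real \<Rightarrow> real" where
  "log_product x = (\<Sum>i=1..p. \<alpha> i * ln (q_Gamma q (A i * x + a i)))"

text \<open>The affine part of \<open>log \<Gamma>\<^sub>q\<close> disappears in the second derivative, and the exponential
  series contributes \<open>(log q)\<^sup>2\<close> times the Laplace transform of the discrete measure.\<close>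

lemma log_product_derivatives:
  obtains D where "\<And>x. x > 0 \<Longrightarrow> (log_product has_real_derivative D x) (at x)"
    and "\<And>x. x > 0 \<Longrightarrow> (D has_real_derivative (ln q)\<^sup>2 * moment 0 x) (at x)"
proof
  define E where "E i x = (\<Sum>n. log_coeff i n * exp (- (x * node i n)))" for i x
  define E1 where "E1 i x = - (\<Sum>n. log_coeff i n * node i n * exp (- (x * node i n)))" for i x
  define D where "D x = (\<Sum>i=1..p. - (\<alpha> i * (A i * ln (1 - q))) + E1 i x)" for x
  have E: "(E i has_real_derivative E1 i x) (at x)" if "i \<in> {1..p}" "x > 0" for i x
    unfolding E_def E1_def using that
    by (intro exp_series_derivative(2) spacing_pos summable_log_coeff)
  have E1: "(E1 i has_real_derivative 
      (ln q)\<^sup>2 * (\<Sum>n. weight i n * exp (- (x * node i n)))) (at x)"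
    if i: "i \<in> {1..p}" and x: "x > 0" for i x
  proof -
    have "(\<Sum>n. log_coeff i n * node i n * node i n * exp (- (x * node i n)))
      = (\<Sum>n. (ln q)\<^sup>2 * (weight i n * exp (- (x * node i n))))"
      using log_coeff_second_moment[of i] by (simp add: power2_eq_square mult.assoc)
    also have "\<dots> = (ln q)\<^sup>2 * (\<Sum>n. weight i n * exp (- (x * node i n)))"
      by (rule suminf_mult[OF summable_weight[OF i x]])
    finally show ?thesis
      using DERIV_minus[OF exp_series_derivative(2)[OF spacing_pos[OF i] _ x,
            OF exp_series_derivative(1)[OF spacing_pos[OF i] summable_log_coeff[OF i]]]]
      unfolding E1_def by (simp add: mult_ac)
  qed
  have log: "log_product x = (\<Sum>i=1..p. \<alpha> i * ((1 - (A i * x + a i)) * ln (1 - q) - q_log_series q q) + E i x)"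
    if x: "x > 0" for x
    unfolding log_product_def
  proof (rule sum.cong)
    fix i assume i: "i \<in> {1..p}"
    have "E i x = \<alpha> i * q_log_series q (q powr (A i * x + a i))"
      unfolding E_def log_coeff_exp q_log_series_def
      by (intro suminf_mult summable_q_log_series q_pos q_less_1 norm_powr_argument i x)
    then show "\<alpha> i * ln (q_Gamma q (A i * x + a i)) =
        \<alpha> i * ((1 - (A i * x + a i)) * ln (1 - q) - q_log_series q q) + E i x"
      using q_Gamma_eq_exp[OF q_pos q_less_1 argument_pos[OF i x]] by (simp add: algebra_simps)
  qed simp
  fix x :: real assume x: "x > 0"
  have "((\<lambda>x. \<Sum>i=1..p. \<alpha> i * ((1 - (A i * x + a i)) * ln (1 - q) - q_log_series q q) + E i x)
     has_real_derivative D x) (at x)"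
    unfolding D_def
    by (intro DERIV_sum DERIV_add) (auto intro!: derivative_eq_intros E x)
  then show "(log_product has_real_derivative D x) (at x)"
    by (rule has_field_derivative_transform_within_open[of _ _ _ "{0<..}"]) (use x log in auto)
  show "(D has_real_derivative (ln q)\<^sup>2 * moment 0 x) (at x)"
    unfolding D_def moment_def sum_distrib_left power_0 mult_1_right
    by (rule DERIV_sum) (auto intro!: derivative_eq_intros E1 x)
qed

section \<open>The discrete measure and its atoms\<close>

lemma finite_atoms_at: "i \<in> {1..p} \<Longrightarrow> finite {n. n \<ge> 1 \<and> node i n = t}"
  using spacing_pos[of i] 
  by (intro finite_subset[OF _ finite_vimageI[of "{t}" "\<lambda>n. node i n"]]) (auto simp: inj_on_def)

lemma mass_eq_iterated_sum:
  "mass t = (\<Sum>i=1..p. \<Sum>n | n \<ge> 1 \<and> node i n = t. weight i n)"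
proof -
  have "(\<Sum>i=1..p. \<Sum>n | n \<ge> 1 \<and> node i n = t. weight i n)
    = (\<Sum>(i, n) \<in> (SIGMA i:{1..p}. {n. n \<ge> 1 \<and> node i n = t}). weight i n)"
    by (rule sum.Sigma) (simp, intro ballI finite_atoms_at)
  also have "\<dots> = mass t"
    unfolding mass_def
    by (rule sum.reindex_bij_witness[of _ prod.swap prod.swap]) (auto simp: spacing_def mult.assoc)
  finally show ?thesis ..
qed

lemma mass_eq_suminf:
  "mass t = (\<Sum>i=1..p. \<Sum>n. if node i n = t then weight i n else 0)"
  unfolding mass_eq_iterated_sum
proof (rule sum.cong)
  fix i assume i: "i \<in> {1..p}"
  have "(\<Sum>n. if node i n = t then weight i n else 0) =
    (\<Sum>n | n \<ge> 1 \<and> node i n = t. if node i n = t then weight i n else 0)"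
    by (rule suminf_finite[OF finite_atoms_at[OF i]]) (auto simp: not_le)
  then show "(\<Sum>n | n \<ge> 1 \<and> node i n = t. weight i n) =
    (\<Sum>n. if node i n = t then weight i n else 0)" by simp
qed simp

lemma ennreal_mass:
  "ennreal (mass t) = (\<Sum>i=1..p. \<Sum>n. ennreal (weight i n) * indicator {t} (node i n))"
proof -
  have "(\<Sum>n. ennreal (weight i n) * indicator {t} (node i n)) =
     ennreal (\<Sum>n | n \<ge> 1 \<and> node i n = t. weight i n)" if i: "i \<in> {1..p}" for i
  proof -
    have "(\<Sum>n. ennreal (weight i n) * indicator {t} (node i n)) =
      (\<Sum>n | n \<ge> 1 \<and> node i n = t. ennreal (weight i n) * indicator {t} (node i n))"
      by (rule suminf_finite[OF finite_atoms_at[OF i]]) (auto simp: not_le indicator_def)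
    also have "\<dots> = ennreal (\<Sum>n | n \<ge> 1 \<and> node i n = t. weight i n)"
      using weight_nonneg[OF i] by (simp add: sum_ennreal)
    finally show ?thesis .
  qed
  moreover have "(\<Sum>i=1..p. ennreal (\<Sum>n | n \<ge> 1 \<and> node i n = t. weight i n))
    = ennreal (mass t)"
    unfolding mass_eq_iterated_sum by (rule sum_ennreal) (auto intro!: sum_nonneg weight_nonneg)
  ultimately show ?thesis by simp
qed

lemma mass_nonneg: "mass t \<ge> 0"
  unfolding mass_eq_iterated_sum by (auto intro!: sum_nonneg weight_nonneg)

lemma mass_pos_iff: "mass t > 0 \<longleftrightarrow> t \<in> support_points q p A"
proof -
  have "mass t > 0 \<longleftrightarrow> (\<exists>i\<in>{1..p}. \<exists>n\<ge>1. node i n = t)"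
  proof
    assume "mass t > 0"
    then obtain i where i: "i \<in> {1..p}" "(\<Sum>n | n \<ge> 1 \<and> node i n = t. weight i n) \<noteq> 0"
      unfolding mass_eq_iterated_sum by (metis (no_types, lifting) less_irrefl sum.neutral)
    then have "{n. n \<ge> 1 \<and> node i n = t} \<noteq> {}" by (metis sum.empty)
    then show "\<exists>i\<in>{1..p}. \<exists>n\<ge>1. node i n = t" using i by blast
  next
    assume "\<exists>i\<in>{1..p}. \<exists>n\<ge>1. node i n = t"
    then obtain i n where i: "i \<in> {1..p}" "n \<ge> 1" "node i n = t" by blast
    then have "(\<Sum>n | n \<ge> 1 \<and> node i n = t. weight i n) > 0"
      using sum_pos2[OF finite_atoms_at[OF i(1), of t], of n "weight i"]
        weight_pos[OF i(1,2)] weight_nonneg[OF i(1)] by simp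
    then show "mass t > 0" unfolding mass_eq_iterated_sum
      by (rule sum_pos2[OF _ i(1), rotated]) (simp_all add: sum_nonneg weight_nonneg)
  qed
  then show ?thesis by (fastforce simp: support_points_def spacing_def mult.assoc)
qed

lemma pos_if_mass_pos: "mass t > 0 \<Longrightarrow> t > 0"
  unfolding mass_pos_iff using params q_pos q_less_1 by (fastforce simp: support_points_def)

lemma moment_Post_Widder:
  assumes t: "t > 0"
  shows "(\<lambda>k. (exp 1 / t) ^ k * moment k (real k / t)) \<longlonglongrightarrow> mass t"
  unfolding moment_def sum_distrib_left mass_eq_suminf
  by (intro tendsto_sum exp_series_Post_Widder spacing_pos summable_weight weight_nonneg t)

text \<open>Collecting equal points: the sum over all index pairs becomes one over the points of the
  half-line.  Taking \<open>h\<close> to be an indicator function gives the measure of a set, and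
  \<open>t\<^sup>k e\<^sup>-\<^sup>x\<^sup>t\<close> gives the moments.\<close>

lemma nn_integral_mass:
  "(\<integral>\<^sup>+t. ennreal (mass t) * h t \<partial>count_space {0<..})
     = (\<Sum>i=1..p. \<Sum>n. ennreal (weight i n) * h (node i n))"
proof -
  have atom: "(\<integral>\<^sup>+t. ennreal (weight i n) * indicator {t} (node i n) * h t \<partial>count_space {0<..})
     = ennreal (weight i n) * h (node i n)" (is "?l = ?r") if i: "i \<in> {1..p}" for i n
  proof (cases "n = 0")
    case False
    then have "node i n > 0" using spacing_pos[OF i] by simp
    moreover have "?l = (\<integral>\<^sup>+t. ?r * indicator {node i n} t \<partial>count_space {0<..})"
      by (rule nn_integral_cong) (auto simp: indicator_def)
    ultimately show ?thesis by (simp add: nn_integral_cmult_indicator)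
  qed simp
  have "(\<integral>\<^sup>+t. ennreal (mass t) * h t \<partial>count_space {0<..}) =
    (\<integral>\<^sup>+t. (\<Sum>i=1..p. \<Sum>n. ennreal (weight i n) * indicator {t} (node i n) * h t) \<partial>count_space {0<..})"
    by (simp add: ennreal_mass sum_distrib_right)
  also have "\<dots> = (\<Sum>i=1..p. \<Sum>n. \<integral>\<^sup>+t. ennreal (weight i n) * indicator {t} (node i n) * h t \<partial>count_space {0<..})"
    by (subst nn_integral_sum, simp) (subst nn_integral_suminf, simp_all)
  also have "\<dots> = (\<Sum>i=1..p. \<Sum>n. ennreal (weight i n) * h (node i n))"
    by (rule sum.cong) (simp_all only: atom)
  finally show ?thesis .
qed

lemma nn_integral_mass_moment:
  assumes x: "x > 0"
  shows "(\<integral>\<^sup>+t. ennreal (mass t) * ennreal (t ^ k * exp (- (x * t))) \<partial>count_space {0<..}) = ennreal (moment k x)"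
proof -
  have i: "(\<Sum>n. ennreal (weight i n) * ennreal (node i n ^ k * exp (- (x * node i n))))
    = ennreal (\<Sum>n. weight i n * node i n ^ k * exp (- (x * node i n)))"
    if i: "i \<in> {1..p}" for i
  proof (subst suminf_ennreal2 [symmetric])
    show nn: "0 \<le> weight i n * node i n ^ k * exp (- (x * node i n))" for n
      using spacing_pos[OF i] weight_nonneg[OF i] by auto
    show "summable (\<lambda>n. weight i n * node i n ^ k * exp (- (x * node i n)))"
      by (rule summable_moment[OF i x])
  qed (use spacing_pos[OF i] weight_nonneg[OF i] in \<open>simp add: mult.assoc flip: ennreal_mult'\<close>)
  have "(\<Sum>i=1..p. ennreal (\<Sum>n. weight i n * node i n ^ k * exp (- (x * node i n))))
    = ennreal (moment k x)"
    unfolding moment_def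
  proof (rule sum_ennreal)
    fix i assume i: "i \<in> {1..p}"
    show "0 \<le> (\<Sum>n. weight i n * node i n ^ k * exp (- (x * node i n)))"
      using spacing_pos[OF i] weight_nonneg[OF i] by (intro suminf_nonneg summable_moment i x) auto
  qed
  then show ?thesis unfolding nn_integral_mass by (simp add: i)
qed

lemma moment_nonneg:
  assumes x: "x > 0"
  shows "moment k x \<ge> 0"
  unfolding moment_def
proof (intro sum_nonneg suminf_nonneg summable_moment x)
  fix i n assume "i \<in> {1..p}"
  then show "0 \<le> weight i n * node i n ^ k * exp (- (x * node i n))"
    using spacing_pos[of i] weight_nonneg[of i n] by auto
qed

lemma emeasure_eq_nn_integral_mass:
  assumes S: "S \<in> sets half_line"
  shows "emeasure (discrete_measure q p A a \<alpha>) S = (\<integral>\<^sup>+t. ennreal (mass t) * indicator S t \<partial>count_space {0<..})"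
proof -
  have "(\<Sum>n. ennreal (weight i n) * indicator S (node i n)) =
     (\<Sum>n. ennreal (weight i (Suc n)) * indicator S (real (Suc n) * A i * ln (1 / q)))" for i
    by (subst suminf_offset[of _ 1]) (auto simp: spacing_def mult.assoc)
  then show ?thesis
    unfolding nn_integral_mass
    using emeasure_discrete_measure[OF q_pos q_less_1 _ S, of p A a \<alpha>] params by simp
qed

lemma emeasure_bounded_finite:
  assumes "S \<in> sets half_line" "bounded S"
  shows "emeasure (discrete_measure q p A a \<alpha>) S < \<infinity>"
  using emeasure_discrete_measure_bounded[OF q_pos q_less_1 _ assms] params by blast

lemma measure_singleton:
  assumes "t > 0"
  shows "measure (discrete_measure q p A a \<alpha>) {t} = mass t"
proof -
  have "{t} \<in> sets half_line" using assms by (auto simp: sets_restrict_space_iff)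
  moreover have "(\<integral>\<^sup>+s. ennreal (mass s) * indicator {t} s \<partial>count_space {0<..})
      = (\<integral>\<^sup>+s. ennreal (mass t) * indicator {t} s \<partial>count_space {0<..})"
    by (rule nn_integral_cong) (simp add: indicator_def)
  ultimately have "emeasure (discrete_measure q p A a \<alpha>) {t} = ennreal (mass t)"
    using assms by (simp add: emeasure_eq_nn_integral_mass nn_integral_cmult_indicator)
  then show ?thesis using mass_nonneg by (simp add: measure_def)
qed

end

section \<open>The signed difference of two discrete measures\<close>

locale q_Gamma_ratio =
  num: q_Gamma_product q p A a \<alpha> + den: q_Gamma_product q s B b \<beta>
  for q :: real and p s :: nat and A a \<alpha> B b \<beta> :: "nat \<Rightarrow> real"
begin

abbreviation \<mu> where "\<mu> \<equiv> discrete_measure q p A a \<alpha>"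
abbreviation \<sigma> where "\<sigma> \<equiv> discrete_measure q s B b \<beta>"
abbreviation \<tau> where "\<tau> \<equiv> signed_diff \<mu> \<sigma>"

definition excess :: "real \<Rightarrow> real" where
  "excess t = num.mass t - den.mass t"

text \<open>This is the candidate for \<open>\<tau>\<close> as a genuine measure.  Where \<open>excess\<close> is negative, \<open>ennreal\<close>
  truncates it to 0; the lemmas below identify the measure with \<open>\<tau>\<close> only when this does
  not happen on the half-line.\<close>

definition excess_measure :: "real measure" where
  "excess_measure = distr (point_measure {0<..} (\<lambda>t. ennreal (excess t))) half_line id"

lemma nn_integral_excess_measure:
  assumes h: "h \<in> borel_measurable half_line"
  shows "(\<integral>\<^sup>+t. h t \<partial>excess_measure) = (\<integral>\<^sup>+t. ennreal (excess t) * h t \<partial>count_space {0<..})"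
proof -
  have "(\<integral>\<^sup>+t. h t \<partial>excess_measure) = (\<integral>\<^sup>+t. h t \<partial>point_measure {0<..} (\<lambda>t. ennreal (excess t)))"
    unfolding excess_measure_def
    by (subst nn_integral_distr) (use h in \<open>auto simp: point_measure_def space_restrict_space\<close>)
  also have "\<dots> = (\<integral>\<^sup>+t. ennreal (excess t) * h t \<partial>count_space {0<..})"
    unfolding point_measure_def by (rule nn_integral_density) auto
  finally show ?thesis .
qed

lemma sets_excess_measure: "sets excess_measure = sets half_line"
  by (simp add: excess_measure_def)

lemma nn_integral_excess:
  assumes "\<And>t. t > 0 \<Longrightarrow> excess t \<ge> 0"
  shows "(\<integral>\<^sup>+t. ennreal (excess t) * h t \<partial>count_space {0<..})
      + (\<integral>\<^sup>+t. ennreal (den.mass t) * h t \<partial>count_space {0<..})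
    = (\<integral>\<^sup>+t. ennreal (num.mass t) * h t \<partial>count_space {0<..})"
proof (subst nn_integral_add [symmetric])
  show "(\<integral>\<^sup>+t. ennreal (excess t) * h t + ennreal (den.mass t) * h t \<partial>count_space {0<..})
    = (\<integral>\<^sup>+t. ennreal (num.mass t) * h t \<partial>count_space {0<..})"
  proof (rule nn_integral_cong)
    fix t :: real assume "t \<in> space (count_space {0<..})"
    then have "ennreal (excess t) + ennreal (den.mass t) = ennreal (num.mass t)"
      using assms[of t] den.mass_nonneg[of t] by (subst ennreal_plus [symmetric]) (auto simp: excess_def)
    then show "ennreal (excess t) * h t + ennreal (den.mass t) * h t = ennreal (num.mass t) * h t"
      by (metis distrib_right)
  qed
qed auto

lemma emeasure_excess_measure:
  assumes excess: "\<And>t. t > 0 \<Longrightarrow> excess t \<ge> 0" and S: "S \<in> sets half_line"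
  shows "emeasure excess_measure S + emeasure \<sigma> S = emeasure \<mu> S"
proof -
  have "emeasure excess_measure S = (\<integral>\<^sup>+t. indicator S t \<partial>excess_measure)"
    using S by (simp add: sets_excess_measure)
  also have "\<dots> = (\<integral>\<^sup>+t. ennreal (excess t) * indicator S t \<partial>count_space {0<..})"
    by (rule nn_integral_excess_measure) (use S in simp)
  finally show ?thesis
    by (simp only: num.emeasure_eq_nn_integral_mass[OF S] den.emeasure_eq_nn_integral_mass[OF S]
        nn_integral_excess[OF excess])
qed

lemma represents_excess_measure:
  assumes excess: "\<And>t. t > 0 \<Longrightarrow> excess t \<ge> 0"
  shows "represents excess_measure \<tau>"
  unfolding represents_def
proof (intro conjI ballI impI)
  fix S assume S: "S \<in> sets half_line" "bounded S"
  note sum = emeasure_excess_measure[OF excess S(1)]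
  have fin: "emeasure \<mu> S < \<infinity>" "emeasure \<sigma> S < \<infinity>"
    using S by (simp_all only: num.emeasure_bounded_finite den.emeasure_bounded_finite)
  then show e: "emeasure excess_measure S < \<infinity>" using sum
    by (metis add_increasing2 infinity_ennreal_def le_less_trans order_refl zero_le)
  have "measure excess_measure S + measure \<sigma> S = measure \<mu> S"
    unfolding measure_def using sum e fin by (metis enn2real_plus infinity_ennreal_def)
  then show "measure excess_measure S = \<tau> S" by (simp add: signed_diff_def)
qed (simp add: sets_excess_measure)

lemma excess_nonneg_if_represents:
  assumes "represents \<nu> \<tau>" and t: "t > 0"
  shows "excess t \<ge> 0"
proof -
  have "{t} \<in> sets half_line" using t by (auto simp: sets_restrict_space_iff)
  then have "measure \<nu> {t} = \<tau> {t}" using assms by (auto simp: represents_def)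
  also have "\<dots> = excess t" using t
    by (simp add: signed_diff_def excess_def num.measure_singleton den.measure_singleton)
  finally show ?thesis by (metis measure_nonneg)
qed

text \<open>The two measures agree on the bounded sets \<open>S \<inter> {0<..k}\<close>, which increase to \<open>S\<close>, so
  continuity from below gives agreement on all of \<open>S\<close>.\<close>

lemma represents_unique:
  assumes \<nu>: "represents \<nu> \<tau>'" and \<nu>': "represents \<nu>' \<tau>'"
  shows "\<nu> = \<nu>'"
proof (rule measure_eqI)
  have sets: "sets \<nu> = sets half_line" "sets \<nu>' = sets half_line"
    using assms by (auto simp: represents_def)
  then show "sets \<nu> = sets \<nu>'" by simp
  fix S assume "S \<in> sets \<nu>"
  then have S: "S \<in> sets half_line" using sets by simp
  define T where "T k = S \<inter> {0<..real k}" for k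
  have T: "T k \<in> sets half_line" "bounded (T k)" for k
  proof -
    have "{0<..real k} \<in> sets half_line" by (auto simp: sets_restrict_space_iff)
    then show "T k \<in> sets half_line" using S unfolding T_def by (rule sets.Int[rotated])
    show "bounded (T k)" unfolding T_def
      by (rule bounded_subset[OF bounded_closed_interval[of 0 "real k"]]) auto
  qed
  have U: "(\<Union>k. T k) = S"
  proof -
    have "S \<subseteq> {0<..}" using S by (auto simp: sets_restrict_space)
    then show ?thesis unfolding T_def using real_arch_simple by fastforce
  qed
  have inc: "incseq T" by (auto simp: incseq_def T_def)
  have "emeasure \<nu> (T k) = emeasure \<nu>' (T k)" for k
  proof -
    have "emeasure \<nu> (T k) < \<infinity>" "emeasure \<nu>' (T k) < \<infinity>" "measure \<nu> (T k) = measure \<nu>' (T k)"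
      using \<nu> \<nu>' T[of k] by (auto simp: represents_def)
    then show ?thesis by (metis emeasure_eq_ennreal_measure infinity_ennreal_def less_irrefl)
  qed
  then show "emeasure \<nu> S = emeasure \<nu>' S"
    using SUP_emeasure_incseq[of T \<nu>] SUP_emeasure_incseq[of T \<nu>'] inc T(1) sets U
    by (simp add: image_subset_iff)
qed

lemma nn_integral_excess_moment:
  assumes excess: "\<And>t. t > 0 \<Longrightarrow> excess t \<ge> 0" and x: "x > 0"
  shows "(\<integral>\<^sup>+t. ennreal (excess t) * ennreal (t ^ k * exp (- (x * t))) \<partial>count_space {0<..})
    + ennreal (den.moment k x) = ennreal (num.moment k x)"
  using nn_integral_excess[OF excess, of "\<lambda>t. ennreal (t ^ k * exp (- (x * t)))"]
  by (simp only: num.nn_integral_mass_moment[OF x] den.nn_integral_mass_moment[OF x])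

lemma moment_mono:
  assumes excess: "\<And>t. t > 0 \<Longrightarrow> excess t \<ge> 0" and x: "x > 0"
  shows "den.moment k x \<le> num.moment k x"
proof -
  have "ennreal (den.moment k x) \<le>
      (\<integral>\<^sup>+t. ennreal (excess t) * ennreal (t ^ k * exp (- (x * t))) \<partial>count_space {0<..})
        + ennreal (den.moment k x)"
    by (rule add_increasing[OF zero_le order_refl])
  also have "\<dots> = ennreal (num.moment k x)"
    by (rule nn_integral_excess_moment[OF excess x])
  finally have "ennreal (den.moment k x) \<le> ennreal (num.moment k x)" .
  then show ?thesis using num.moment_nonneg[OF x, of k] by (simp add: ennreal_le_iff)
qed

lemma excess_measure_Laplace:
  assumes excess: "\<And>t. t > 0 \<Longrightarrow> excess t \<ge> 0" and x: "x > 0"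
  shows "integrable excess_measure (\<lambda>y. exp (- (x * y))) \<and>
    (\<integral>y. exp (- (x * y)) \<partial>excess_measure) = num.moment 0 x - den.moment 0 x"
proof (subst nn_integral_eq_integrable [symmetric])
  have m: "(\<lambda>y. exp (- (x * y))) \<in> borel_measurable half_line"
    by (intro measurable_restrict_space1) measurable
  show "(\<lambda>y. exp (- (x * y))) \<in> borel_measurable excess_measure"
    using m by (simp only: measurable_cong_sets[OF sets_excess_measure refl])
  show "0 \<le> num.moment 0 x - den.moment 0 x" using moment_mono[OF assms, of 0] by simp
  have "(\<integral>\<^sup>+y. ennreal (exp (- (x * y))) \<partial>excess_measure) + ennreal (den.moment 0 x) = ennreal (num.moment 0 x)"
    using nn_integral_excess_moment[OF assms, of 0] m
    by (subst nn_integral_excess_measure) simp_all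
  also have "\<dots> = ennreal (num.moment 0 x - den.moment 0 x) + ennreal (den.moment 0 x)"
    using moment_mono[OF assms, of 0] den.moment_nonneg[OF x, of 0]
    by (subst ennreal_plus [symmetric]) auto
  finally show "(\<integral>\<^sup>+y. ennreal (exp (- (x * y))) \<partial>excess_measure) = ennreal (num.moment 0 x - den.moment 0 x)"
    by (simp add: add.commute[of _ "ennreal (den.moment 0 x)"] ennreal_add_left_cancel)
qed simp

section \<open>The second logarithmic derivative of the quotient\<close>

definition log_ratio'' :: "real \<Rightarrow> real" where
  "log_ratio'' = deriv (deriv (\<lambda>x. ln (q_Gamma_quotient q p A a \<alpha> s B b \<beta> x)))"

lemma log_ratio''_eq:
  assumes x: "x > 0"
  shows "log_ratio'' x = (ln q)\<^sup>2 * (num.moment 0 x - den.moment 0 x)"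
proof -
  obtain D where D: "\<And>x. x > 0 \<Longrightarrow> (num.log_product has_real_derivative D x) (at x)"
    "\<And>x. x > 0 \<Longrightarrow> (D has_real_derivative (ln q)\<^sup>2 * num.moment 0 x) (at x)"
    using num.log_product_derivatives by blast
  obtain E where E: "\<And>x. x > 0 \<Longrightarrow> (den.log_product has_real_derivative E x) (at x)"
    "\<And>x. x > 0 \<Longrightarrow> (E has_real_derivative (ln q)\<^sup>2 * den.moment 0 x) (at x)"
    using den.log_product_derivatives by blast
  have log: "ln (q_Gamma_quotient q p A a \<alpha> s B b \<beta> x) = num.log_product x - den.log_product x"
    if x: "x > 0" for x
  proof -
    have A: "q_Gamma q (A i * x + a i) > 0" if "i \<in> {1..p}" for i
      using q_Gamma_eq_exp[OF num.q_pos num.q_less_1 num.argument_pos[OF that x]] by simp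
    have B: "q_Gamma q (B i * x + b i) > 0" if "i \<in> {1..s}" for i
      using q_Gamma_eq_exp[OF num.q_pos num.q_less_1 den.argument_pos[OF that x]] by simp
    have "(\<Prod>i=1..p. q_Gamma q (A i * x + a i) powr \<alpha> i) > 0" (is "?N > 0")
      by (intro prod_pos) (use A in \<open>fastforce simp: less_le\<close>)
    moreover have "(\<Prod>i=1..s. q_Gamma q (B i * x + b i) powr \<beta> i) > 0" (is "?D > 0")
      by (intro prod_pos) (use B in \<open>fastforce simp: less_le\<close>)
    moreover have "ln (\<Prod>i=1..p. q_Gamma q (A i * x + a i) powr \<alpha> i) = num.log_product x"
      unfolding num.log_product_def using A by (subst ln_prod) (force simp: ln_powr)+
    moreover have "ln (\<Prod>i=1..s. q_Gamma q (B i * x + b i) powr \<beta> i) = den.log_product x"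
      unfolding den.log_product_def using B by (subst ln_prod) (force simp: ln_powr)+
    ultimately show ?thesis by (simp only: q_Gamma_quotient_def ln_divide_pos)
  qed
  have d1: "deriv (\<lambda>x. ln (q_Gamma_quotient q p A a \<alpha> s B b \<beta> x)) x = D x - E x" if x: "x > 0" for x
  proof (rule DERIV_imp_deriv)
    show "((\<lambda>x. ln (q_Gamma_quotient q p A a \<alpha> s B b \<beta> x)) has_real_derivative D x - E x) (at x)"
      by (rule has_field_derivative_transform_within_open[OF DERIV_diff[OF D(1)[OF x] E(1)[OF x]], of "{0<..}"])
        (use x log in auto)
  qed
  show ?thesis unfolding log_ratio''_def
  proof (rule DERIV_imp_deriv)
    show "(deriv (\<lambda>x. ln (q_Gamma_quotient q p A a \<alpha> s B b \<beta> x))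
        has_real_derivative (ln q)\<^sup>2 * (num.moment 0 x - den.moment 0 x)) (at x)"
      by (rule has_field_derivative_transform_within_open[of "\<lambda>x. D x - E x" _ _ "{0<..}"])
        (use x d1 in \<open>auto intro!: derivative_eq_intros D(2) E(2) simp: right_diff_distrib\<close>)
  qed
qed

text \<open>The hypothesis concerns the half-line only, but that is open, so it determines the
  derivative there; this is the induction step for all higher derivatives.\<close>

lemma has_derivative_if_moment_difference:
  assumes g: "\<And>x. x > 0 \<Longrightarrow> g x = (-1) ^ k * ((ln q)\<^sup>2 * (num.moment k x - den.moment k x))"
    and x: "x > 0"
  shows "(g has_real_derivative
    (-1) ^ Suc k * ((ln q)\<^sup>2 * (num.moment (Suc k) x - den.moment (Suc k) x))) (at x)"
proof (rule has_field_derivative_transform_within_open[of _ _ _ "{0<..}"])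
  show "((\<lambda>x. (-1) ^ k * ((ln q)\<^sup>2 * (num.moment k x - den.moment k x))) has_real_derivative
    (-1) ^ Suc k * ((ln q)\<^sup>2 * (num.moment (Suc k) x - den.moment (Suc k) x))) (at x)"
    by (auto intro!: derivative_eq_intros num.moment_has_derivative den.moment_has_derivative x
          simp: algebra_simps)
qed (use g x in auto)

lemma higher_deriv_log_ratio'':
  "x > 0 \<Longrightarrow> (deriv ^^ k) log_ratio'' x = (-1) ^ k * ((ln q)\<^sup>2 * (num.moment k x - den.moment k x))"
proof (induction k arbitrary: x)
  case (Suc k)
  show ?case
    using DERIV_imp_deriv[OF has_derivative_if_moment_difference[OF Suc.IH Suc.prems]] by simp
qed (simp add: log_ratio''_eq)

lemma ln_q_power2_pos: "(ln q)\<^sup>2 > 0"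
  using num.q_pos num.q_less_1 by simp

text \<open>Up to the factor \<open>(log q)\<^sup>2\<close>, the atoms of \<open>\<tau>\<close> are limits of the rescaled derivatives
  \<open>(e/t)\<^sup>k (-1)\<^sup>k f\<^sup>(\<^sup>k\<^sup>) (k/t)\<close>, so the sign conditions on the derivatives pass to them.
  Conversely, each signed derivative is a Laplace integral against the atoms.\<close>

lemma completely_monotonic_iff_excess:
  "completely_monotonic log_ratio'' \<longleftrightarrow> (\<forall>t>0. excess t \<ge> 0)"
proof
  assume cm: "completely_monotonic log_ratio''"
  have mono: "0 \<le> num.moment k x - den.moment k x" if x: "x > 0" for k x
  proof -
    have "0 \<le> (-1) ^ k * (deriv ^^ k) log_ratio'' x"
      using cm x by (cases "k = 0") (auto simp: completely_monotonic_def Suc_le_eq)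
    also have "\<dots> = (ln q)\<^sup>2 * (num.moment k x - den.moment k x)"
      unfolding higher_deriv_log_ratio''[OF x] by simp
    finally show ?thesis using ln_q_power2_pos by (simp add: zero_le_mult_iff)
  qed
  show "\<forall>t>0. excess t \<ge> 0"
  proof (intro allI impI)
    fix t :: real assume t: "t > 0"
    have "(\<lambda>k. (exp 1 / t) ^ k * num.moment k (real k / t)
        - (exp 1 / t) ^ k * den.moment k (real k / t)) \<longlonglongrightarrow> excess t"
      unfolding excess_def by (intro tendsto_diff num.moment_Post_Widder den.moment_Post_Widder t)
    moreover have "\<forall>\<^sub>F k in sequentially. 0 \<le> (exp 1 / t) ^ k * num.moment k (real k / t)
        - (exp 1 / t) ^ k * den.moment k (real k / t)"
    proof (rule eventually_mono[OF eventually_gt_at_top[of 0]])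
      fix k :: nat assume "k > 0"
      then have "0 \<le> (exp 1 / t) ^ k * (num.moment k (real k / t) - den.moment k (real k / t))"
        using t by (intro mult_nonneg_nonneg mono) auto
      then show "0 \<le> (exp 1 / t) ^ k * num.moment k (real k / t)
        - (exp 1 / t) ^ k * den.moment k (real k / t)"
        by (simp only: right_diff_distrib)
    qed
    ultimately show "excess t \<ge> 0" by (rule tendsto_lowerbound) simp
  qed
next
  assume excess: "\<forall>t>0. excess t \<ge> 0"
  have sign: "0 \<le> (-1) ^ k * (deriv ^^ k) log_ratio'' x" if x: "x > 0" for k x
  proof -
    have "0 \<le> (ln q)\<^sup>2 * (num.moment k x - den.moment k x)"
      using moment_mono[of x k] excess x by (auto intro!: mult_nonneg_nonneg)
    also have "\<dots> = (-1) ^ k * (deriv ^^ k) log_ratio'' x"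
      unfolding higher_deriv_log_ratio''[OF x] by simp
    finally show ?thesis .
  qed
  show "completely_monotonic log_ratio''"
    unfolding completely_monotonic_def
  proof (intro conjI allI impI)
    fix n and x :: real assume "x > 0"
    then show "(deriv ^^ n) log_ratio'' field_differentiable at x"
      using has_derivative_if_moment_difference[OF higher_deriv_log_ratio''] unfolding field_differentiable_def by blast
  next
    fix x :: real assume "x > 0"
    then show "0 \<le> log_ratio'' x" using sign[of x 0] by simp
  qed (use sign in auto)
qed

lemma is_nonneg_measure_iff_excess: "is_nonneg_measure \<tau> \<longleftrightarrow> (\<forall>t>0. excess t \<ge> 0)"
proof
  assume "is_nonneg_measure \<tau>"
  then obtain \<nu> where "represents \<nu> \<tau>" unfolding is_nonneg_measure_def ..
  then show "\<forall>t>0. excess t \<ge> 0" by (intro allI impI excess_nonneg_if_represents)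
next
  assume "\<forall>t>0. excess t \<ge> 0"
  then have "represents excess_measure \<tau>" by (intro represents_excess_measure) simp
  then show "is_nonneg_measure \<tau>" unfolding is_nonneg_measure_def ..
qed

text \<open>Negative excess can occur only at an atom of the denominator; and since these atoms are
  strictly positive, the numerator must have an atom at the same point to compensate.\<close>

lemma excess_nonneg_iff:
  "(\<forall>t>0. excess t \<ge> 0) \<longleftrightarrow>
     support_points q s B \<subseteq> support_points q p A \<and> (\<forall>t\<in>support_points q s B. den.mass t \<le> num.mass t)"
proof (rule iffI)
  assume e: "\<forall>t>0. excess t \<ge> 0"
  have le: "den.mass t \<le> num.mass t" if t: "t \<in> support_points q s B" for t
  proof -
    have "t > 0" by (rule den.pos_if_mass_pos[OF den.mass_pos_iff[THEN iffD2, OF t]])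
    with e show ?thesis by (simp add: excess_def)
  qed
  have "t \<in> support_points q p A" if t: "t \<in> support_points q s B" for t
  proof -
    have "0 < den.mass t" by (rule den.mass_pos_iff[THEN iffD2, OF t])
    also note le[OF t]
    finally show ?thesis by (rule num.mass_pos_iff[THEN iffD1])
  qed
  then have "support_points q s B \<subseteq> support_points q p A" by (rule subsetI)
  moreover have "\<forall>t\<in>support_points q s B. den.mass t \<le> num.mass t" using le by (rule ballI)
  ultimately show "support_points q s B \<subseteq> support_points q p A \<and>
    (\<forall>t\<in>support_points q s B. den.mass t \<le> num.mass t)" ..
next
  assume r: "support_points q s B \<subseteq> support_points q p A \<and>
    (\<forall>t\<in>support_points q s B. den.mass t \<le> num.mass t)"
  have "excess t \<ge> 0" for t
  proof (cases "t \<in> support_points q s B")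
    case True
    then have "den.mass t \<le> num.mass t" by (rule bspec[OF conjunct2[OF r]])
    then show ?thesis by (simp add: excess_def)
  next
    case False
    then have "\<not> 0 < den.mass t" by (simp only: den.mass_pos_iff not_False_eq_True)
    then show ?thesis using num.mass_nonneg[of t] by (simp add: excess_def)
  qed
  then show "\<forall>t>0. excess t \<ge> 0" by (intro allI impI)
qed

section \<open>The characterisation\<close>

text \<open>Inclusion of the points with \<open>m = 1\<close> already gives the divisibility relations, which in
  turn are inherited by all multiples.\<close>

lemma support_points_subset_iff:
  "support_points q s B \<subseteq> support_points q p A \<longleftrightarrow>
     (\<exists>n k :: nat \<Rightarrow> nat. \<forall>j\<in>{1..s}. n j \<ge> 1 \<and> k j \<in> {1..p} \<and> B j = real (n j) * A (k j))"
proof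
  have l: "ln (1 / q) \<noteq> 0" using num.q_pos num.q_less_1 by simp
  assume sub: "support_points q s B \<subseteq> support_points q p A"
  have "\<forall>j\<in>{1..s}. \<exists>n k. n \<ge> 1 \<and> k \<in> {1..p} \<and> B j = real n * A k"
  proof
    fix j assume "j \<in> {1..s}"
    then have "real 1 * B j * ln (1 / q) \<in> support_points q s B" unfolding support_points_def by blast
    then obtain n k where "n \<ge> 1" "k \<in> {1..p}" "real 1 * B j * ln (1 / q) = real n * A k * ln (1 / q)"
      using sub unfolding support_points_def by blast
    moreover from this(3) have "B j = real n * A k" using l by (simp only: mult_cancel_right) simp
    ultimately show "\<exists>n k. n \<ge> 1 \<and> k \<in> {1..p} \<and> B j = real n * A k" by blast
  qed
  then show "\<exists>n k :: nat \<Rightarrow> nat. \<forall>j\<in>{1..s}. n j \<ge> 1 \<and> k j \<in> {1..p} \<and> B j = real (n j) * A (k j)"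
    by metis
next
  assume "\<exists>n k :: nat \<Rightarrow> nat. \<forall>j\<in>{1..s}. n j \<ge> 1 \<and> k j \<in> {1..p} \<and> B j = real (n j) * A (k j)"
  then obtain n k :: "nat \<Rightarrow> nat" where nk: "\<And>j. j \<in> {1..s} \<Longrightarrow> n j \<ge> 1 \<and> k j \<in> {1..p} \<and> B j = real (n j) * A (k j)"
    by blast
  show "support_points q s B \<subseteq> support_points q p A"
  proof
    fix t assume "t \<in> support_points q s B"
    then obtain m j where m: "t = real m * B j * ln (1 / q)" "m \<ge> 1" "j \<in> {1..s}"
      unfolding support_points_def by blast
    then have "t = real (m * n j) * A (k j) * ln (1 / q)" using nk[of j] by simp
    moreover have "m * n j \<ge> 1" "k j \<in> {1..p}" using m(2) nk[OF m(3)] by simp_all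
    ultimately show "t \<in> support_points q p A" unfolding support_points_def by blast
  qed
qed

lemma Laplace_representation:
  assumes \<nu>: "represents \<nu> \<tau>" and x: "x > 0"
  shows "integrable \<nu> (\<lambda>y. exp (- (x * y))) \<and> log_ratio'' x = (ln q)\<^sup>2 * (\<integral>y. exp (- (x * y)) \<partial>\<nu>)"
proof -
  have excess: "\<And>t. t > 0 \<Longrightarrow> excess t \<ge> 0" using excess_nonneg_if_represents[OF \<nu>] .
  have "\<nu> = excess_measure"
    by (rule represents_unique[OF \<nu> represents_excess_measure[OF excess]])
  then show ?thesis using excess_measure_Laplace[OF excess x] log_ratio''_eq[OF x] by simp
qed

end

theorem theorem2p1:
  fixes q :: real and p s :: nat and A a \<alpha> B b \<beta> :: "nat \<Rightarrow> real"
  assumes "0 < q" and "q < 1"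
    and "\<And>i. i \<in> {1..p} \<Longrightarrow> A i > 0 \<and> \<alpha> i > 0 \<and> a i \<ge> 0"
    and "\<And>j. j \<in> {1..s} \<Longrightarrow> B j > 0 \<and> \<beta> j > 0 \<and> b j \<ge> 0"
  shows "let W = q_Gamma_quotient q p A a \<alpha> s B b \<beta>;
             f = deriv (deriv (\<lambda>x. ln (W x)));
             \<mu> = discrete_measure q p A a \<alpha>;
             \<sigma> = discrete_measure q s B b \<beta>;
             \<tau> = signed_diff \<mu> \<sigma>
         in
           (completely_monotonic f \<longleftrightarrow> is_nonneg_measure \<tau>) \<and>
           (is_nonneg_measure \<tau> \<longleftrightarrow>
              support_points q s B \<subseteq> support_points q p A \<and>
              (\<forall>t\<in>support_points q s B.
                 (\<Sum>(n, i) | n \<ge> 1 \<and> i \<in> {1..p} \<and> real n * A i * ln (1 / q) = t.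
                    atom_weight q A a \<alpha> i n)
                 \<ge> (\<Sum>(m, j) | m \<ge> 1 \<and> j \<in> {1..s} \<and> real m * B j * ln (1 / q) = t.
                    atom_weight q B b \<beta> j m))) \<and>
           (support_points q s B \<subseteq> support_points q p A \<longleftrightarrow>
              (\<exists>n k :: nat \<Rightarrow> nat. \<forall>j\<in>{1..s}.
                 n j \<ge> 1 \<and> k j \<in> {1..p} \<and> B j = real (n j) * A (k j))) \<and>
           (\<forall>\<nu>. represents \<nu> \<tau> \<longrightarrow>
              (\<forall>x>0. integrable \<nu> (\<lambda>y. exp (- (x * y))) \<and>
                 f x = (ln q)\<^sup>2 * (\<integral>y. exp (- (x * y)) \<partial>\<nu>)))"
proof -
  interpret q_Gamma_ratio q p s A a \<alpha> B b \<beta>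
    by unfold_locales (use assms in auto)
  show ?thesis
    unfolding Let_def log_ratio''_def [symmetric] num.mass_def [symmetric] den.mass_def [symmetric]
  proof (intro conjI allI impI)
    show "completely_monotonic log_ratio'' \<longleftrightarrow> is_nonneg_measure \<tau>"
      by (simp only: completely_monotonic_iff_excess is_nonneg_measure_iff_excess)
    show "is_nonneg_measure \<tau> \<longleftrightarrow> support_points q s B \<subseteq> support_points q p A \<and>
        (\<forall>t\<in>support_points q s B. den.mass t \<le> num.mass t)"
      by (simp only: excess_nonneg_iff is_nonneg_measure_iff_excess)
    show "support_points q s B \<subseteq> support_points q p A \<longleftrightarrow>
        (\<exists>n k :: nat \<Rightarrow> nat. \<forall>j\<in>{1..s}. n j \<ge> 1 \<and> k j \<in> {1..p} \<and> B j = real (n j) * A (k j))"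
      by (rule support_points_subset_iff)
  next
    fix \<nu> and x :: real assume "represents \<nu> \<tau>" "x > 0"
    then show "integrable \<nu> (\<lambda>y. exp (- (x * y)))"
      "log_ratio'' x = (ln q)\<^sup>2 * (\<integral>y. exp (- (x * y)) \<partial>\<nu>)"
      using Laplace_representation by blast+
  qed
qed
end
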